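(* For every $\rho\in\{\gamma_{\{2\}},\gamma_{t\{2\}},\tilde\gamma_{w2},\gamma_R,\tilde\gamma_{\{2\}},\tilde\gamma_{t\{2\}}\}$ there is a $2(\ln(\Delta(G)+2)+1)$-approximation algorithm for $\rho$, where $\Delta(G)$ is the maximum degree of the input graph $G$.
   Context: All graphs are finite, simple and undirected; $N(v)$, $N[v]$ are open and closed neighborhoods. For numeric $f$, $f(W)=\sum_{w\in W}f(w)$; for set-valued $f$, $f(W)=\sum_{w\in W}|f(w)|$, $f_\cup(W)=\bigcup_{w\in W}f(w)$. Each parameter is the minimum of $f(V)$ over the functions: $\gamma_{\{2\}}$: $f:V\to\{0,1,2\}$, $f(N[v])\ge2$ for all $v$; $\gamma_{t\{2\}}$: $f:V\to\{0,1,2\}$, $f(N(v))\ge 2$ for all $v$; $\gamma_R$: $f:V\to\{0,1,2\}$, every $v$ with $f(v)=0$ has a neighbor $w$ with $f(w)=2$; $\tilde\gamma_{w2}$: $f:V\to\mathcal P(\{a,b\})$, $f_\cup(N(v))=\{a,b\}$ whenever $f(v)=\emptyset$; $\tilde\gamma_{\{2\}}$: $f:V\to\mathcal P(\{a,b\})$, $f_\cup(N[v])=\{a,b\}$ for all $v$; $\tilde\gamma_{t\{2\}}$: $f:V\to\mathcal P(\{a,b\})$, $f_\cup(N(v))=\{a,b\}$ for all $v$. A $c$-approximation algorithm is a polynomial-time algorithm that, on every input graph $G$ for which $\rho(G)$ is finite, outputs a feasible function for $\rho$ of weight at most $c\cdot\rho(G)$. *)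

theory Defs
  imports
    Complex_Main
    "HOL-Library.Extended_Nat"
    "HOL-Computational_Algebra.Polynomial"
    "Graph_Theory.Pair_Digraph"
begin

section \<open>Graphs\<close>

text \<open>
  Finite simple undirected graphs are the \<open>pair_graph\<close>s of the AFP entry Graph\_Theory: finite,
  loop-free digraphs without parallel arcs whose arc set is symmetric.
\<close>

definition open_nbhd :: "'v pair_pre_digraph \<Rightarrow> 'v \<Rightarrow> 'v set" where
  "open_nbhd G v = {w. (v, w) \<in> parcs G}"

definition closed_nbhd :: "'v pair_pre_digraph \<Rightarrow> 'v \<Rightarrow> 'v set" where
  "closed_nbhd G v = insert v (open_nbhd G v)"

text \<open>The element 0 is inserted only to give the graph without vertices maximum degree 0.\<close>

definition max_degree :: "'v pair_pre_digraph \<Rightarrow> nat" where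
  "max_degree G = Max (insert 0 ((\<lambda>v. card (open_nbhd G v)) ` pverts G))"


section \<open>Domination parameters\<close>

datatype colour = A | B

text \<open>
  Each of the following is the set of feasible functions of a parameter. Values outside the vertex
  set are left unconstrained and are never used.
\<close>

definition two_dom :: "'v pair_pre_digraph \<Rightarrow> ('v \<Rightarrow> nat) set" where
  "two_dom G = {f. f \<in> pverts G \<rightarrow> {0, 1, 2} \<and>
     (\<forall>v\<in>pverts G. (\<Sum>w\<in>closed_nbhd G v. f w) \<ge> 2)}"

definition total_two_dom :: "'v pair_pre_digraph \<Rightarrow> ('v \<Rightarrow> nat) set" where
  "total_two_dom G = {f. f \<in> pverts G \<rightarrow> {0, 1, 2} \<and>
     (\<forall>v\<in>pverts G. (\<Sum>w\<in>open_nbhd G v. f w) \<ge> 2)}"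

definition roman_dom :: "'v pair_pre_digraph \<Rightarrow> ('v \<Rightarrow> nat) set" where
  "roman_dom G = {f. f \<in> pverts G \<rightarrow> {0, 1, 2} \<and>
     (\<forall>v\<in>pverts G. f v = 0 \<longrightarrow> (\<exists>w\<in>open_nbhd G v. f w = 2))}"

definition weak_two_rainbow_dom :: "'v pair_pre_digraph \<Rightarrow> ('v \<Rightarrow> colour set) set" where
  "weak_two_rainbow_dom G = {f. \<forall>v\<in>pverts G. f v = {} \<longrightarrow> (\<Union>w\<in>open_nbhd G v. f w) = {A, B}}"

definition rainbow_two_dom :: "'v pair_pre_digraph \<Rightarrow> ('v \<Rightarrow> colour set) set" where
  "rainbow_two_dom G = {f. \<forall>v\<in>pverts G. (\<Union>w\<in>closed_nbhd G v. f w) = {A, B}}"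

definition rainbow_total_two_dom :: "'v pair_pre_digraph \<Rightarrow> ('v \<Rightarrow> colour set) set" where
  "rainbow_total_two_dom G = {f. \<forall>v\<in>pverts G. (\<Union>w\<in>open_nbhd G v. f w) = {A, B}}"

definition weight :: "('c \<Rightarrow> nat) \<Rightarrow> 'v pair_pre_digraph \<Rightarrow> ('v \<Rightarrow> 'c) \<Rightarrow> nat" where
  "weight sz G f = (\<Sum>v\<in>pverts G. sz (f v))"

text \<open>The value is \<open>\<infinity>\<close> if there is no feasible function, and the minimum weight otherwise.\<close>

definition parameter ::
  "('c \<Rightarrow> nat) \<Rightarrow> ('v pair_pre_digraph \<Rightarrow> ('v \<Rightarrow> 'c) set) \<Rightarrow> 'v pair_pre_digraph \<Rightarrow> enat" where
  "parameter sz feas G = (INF f\<in>feas G. enat (weight sz G f))"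


section \<open>Polynomial-time algorithms\<close>

text \<open>
  Structured programs for a random access machine with registers and an indirectly addressed
  memory, both holding natural numbers. The cost is the number of instructions and tests executed.
  There is no multiplication or shift instruction, so after \<open>t\<close> steps all numbers have
  bit length at most that of the largest initial number or program constant plus \<open>t\<close>;
  hence unit cost is polynomially related to logarithmic cost and to Turing machine time.
\<close>

type_synonym config = "(nat \<Rightarrow> nat) \<times> (nat \<Rightarrow> nat)"  \<comment> \<open>registers and memory\<close>

datatype com =
    Const nat nat
  | Add nat nat nat
  | Sub nat nat nat
  | Load nat nat
  | Store nat nat
  | Skip
  | Seq com com
  | IfNZ nat com com
  | WhileNZ nat com

text \<open>\<open>exec c s t s'\<close>: started in \<open>s\<close>, the program \<open>c\<close> halts in \<open>s'\<close> after \<open>t\<close> steps.\<close>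

inductive exec :: "com \<Rightarrow> config \<Rightarrow> nat \<Rightarrow> config \<Rightarrow> bool" where
  Const: "exec (Const i k) (r, m) 1 (r(i := k), m)"
| Add: "exec (Add i j k) (r, m) 1 (r(i := r j + r k), m)"
| Sub: "exec (Sub i j k) (r, m) 1 (r(i := r j - r k), m)"
| Load: "exec (Load i j) (r, m) 1 (r(i := m (r j)), m)"
| Store: "exec (Store i j) (r, m) 1 (r, m(r i := r j))"
| Skip: "exec Skip s 1 s"
| Seq: "exec c1 s t1 s' \<Longrightarrow> exec c2 s' t2 s'' \<Longrightarrow> exec (Seq c1 c2) s (t1 + t2) s''"
| IfTrue: "fst s i \<noteq> 0 \<Longrightarrow> exec c1 s t s' \<Longrightarrow> exec (IfNZ i c1 c2) s (1 + t) s'"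
| IfFalse: "fst s i = 0 \<Longrightarrow> exec c2 s t s' \<Longrightarrow> exec (IfNZ i c1 c2) s (1 + t) s'"
| WhileFalse: "fst s i = 0 \<Longrightarrow> exec (WhileNZ i c) s 1 s"
| WhileTrue: "fst s i \<noteq> 0 \<Longrightarrow> exec c s t1 s' \<Longrightarrow> exec (WhileNZ i c) s' t2 s'' \<Longrightarrow>
    exec (WhileNZ i c) s (1 + t1 + t2) s''"

text \<open>
  Input graphs have vertices \<open>0, \<dots>, n - 1\<close>. Initially register 0 contains \<open>n\<close> and the memory
  contains the adjacency matrix, row by row; everything else is 0.
\<close>

definition input_graph :: "nat pair_pre_digraph \<Rightarrow> bool" where
  "input_graph G \<longleftrightarrow> pair_graph G \<and> pverts G = {..<card (pverts G)}"

definition input_config :: "nat pair_pre_digraph \<Rightarrow> config" where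
  "input_config G = (let n = card (pverts G) in
     (\<lambda>i. if i = 0 then n else 0,
      \<lambda>a. if a < n * n \<and> (a div n, a mod n) \<in> parcs G then 1 else 0))"

text \<open>
  The input has size of order \<open>n\<^sup>2\<close>, so a bound polynomial in \<open>n\<close> is the same as a bound
  polynomial in the input size.
\<close>

definition polynomial_time :: "com \<Rightarrow> bool" where
  "polynomial_time P \<longleftrightarrow> (\<exists>p :: nat poly. \<forall>G. input_graph G \<longrightarrow>
     (\<exists>t s. exec P (input_config G) t s \<and> t \<le> poly p (card (pverts G))))"

text \<open>
  The output function is read off the first \<open>n\<close> memory cells at termination; the function values
  are encoded as numbers by \<open>enc\<close>.
\<close>

definition outputs :: "('c \<Rightarrow> nat) \<Rightarrow> com \<Rightarrow> nat pair_pre_digraph \<Rightarrow> (nat \<Rightarrow> 'c) \<Rightarrow> bool" where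
  "outputs enc P G f \<longleftrightarrow> (\<exists>t s. exec P (input_config G) t s \<and>
     (\<forall>v\<in>pverts G. snd s v = enc (f v)))"

definition enc_colours :: "colour set \<Rightarrow> nat" where
  "enc_colours X = (if A \<in> X then 1 else 0) + (if B \<in> X then 2 else 0)"

definition approximation_algorithm ::
  "('c \<Rightarrow> nat) \<Rightarrow> ('c \<Rightarrow> nat) \<Rightarrow> (nat pair_pre_digraph \<Rightarrow> (nat \<Rightarrow> 'c) set) \<Rightarrow>
   (nat pair_pre_digraph \<Rightarrow> real) \<Rightarrow> com \<Rightarrow> bool" where
  "approximation_algorithm enc sz feas c P \<longleftrightarrow>
     polynomial_time P \<and>
     (\<forall>G. input_graph G \<and> parameter sz feas G \<noteq> \<infinity> \<longrightarrow>
       (\<exists>f. outputs enc P G f \<and> f \<in> feas G \<and>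
          real (weight sz G f) \<le> c G * real (the_enat (parameter sz feas G))))"

end

theory Submission
  imports Defs "HOL-Analysis.Harmonic_Numbers"
begin

text \<open>
  The vertices on which a feasible function does not vanish form a dominating set, for the two
  total parameters a total dominating set. Conversely, doubling a (total) dominating set, that is
  assigning 2 or both colours to its elements, yields a feasible function. So it suffices to
  approximate set cover by the closed or open neighbourhoods within a factor of
  \<open>ln (\<Delta> + 2) + 1\<close>, which the greedy algorithm does: for any cover \<open>K\<close> and uncovered set
  \<open>U\<close>, each greedy choice lowers the sum over \<open>u\<in>K\<close> of the harmonic numbers of
  \<open>card (S u \<inter> U)\<close> by at least 1.
\<close>

section \<open>Greedy set cover\<close>

text \<open>The total parameters are infinite on graphs with isolated vertices, and the program must
  halt in polynomial time there too. Hence it always makes exactly n rounds, a round without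
  positive gain changing nothing, and the invariant speaks about coverage only relative to a
  hypothetical cover \<open>K\<close>. The machine has no multiplication and tests only for zero;
  row addresses are therefore carried along by addition and subtraction, and truncated subtraction
  replaces comparison. A neighbourhood has at most \<Delta> + 1 elements, so the potential of
  \<open>K\<close> starts at no more than \<open>card K\<close> times the harmonic number of
  \<Delta> + 2, stays nonnegative, and pays for one chosen vertex per unit.\<close>

lemma harm_diff_ge:
  assumes "b \<le> a" "a \<le> g" "0 < g"
  shows "real (a - b) / real g \<le> harm a - harm b"
  using assms(1,2)
proof (induction a rule: dec_induct)
  case (step a)
  \<comment> \<open>The difference of harmonic numbers is a sum of reciprocals of numbers at most
    \<open>g\<close>, each of them at least \<open>1 / g\<close>.\<close>
  have "1 / real g \<le> inverse (real (Suc a))"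
    using step.prems by (simp add: field_simps)
  moreover have "real (Suc a - b) / real g = real (a - b) / real g + 1 / real g"
    using step.hyps by (simp add: Suc_diff_le add_divide_distrib)
  ultimately show ?case
    using step by (simp add: harm_Suc)
qed simp

definition gain :: "('a \<Rightarrow> 'b set) \<Rightarrow> 'b set \<Rightarrow> 'a \<Rightarrow> nat" where
  "gain S U v = card (S v \<inter> U)"

text \<open>Let g be the gain of \<open>v\<close>. Since the gain of \<open>u\<close> is at most g,
  each element that \<open>u\<close> loses lowers its harmonic number by at least 1/g. The losses
  over \<open>K\<close> add up to at least g, because \<open>K\<close> covers everything that
  \<open>v\<close> newly covers.\<close>

lemma greedy_potential_decrease:
  fixes S :: "'a \<Rightarrow> 'b set"
  assumes fin: "finite U" "finite K" and cover: "U \<subseteq> (\<Union>u\<in>K. S u)"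
    and max: "\<And>u. u \<in> K \<Longrightarrow> gain S U u \<le> gain S U v" and pos: "0 < gain S U v"
  shows "1 + (\<Sum>u\<in>K. harm (gain S (U - S v) u)) \<le> (\<Sum>u\<in>K. harm (gain S U u) :: real)"
proof -
  have split: "gain S U u - gain S (U - S v) u = card (S u \<inter> (S v \<inter> U))"
    and le: "gain S (U - S v) u \<le> gain S U u" for u
  proof -
    have "S u \<inter> U = (S u \<inter> (U - S v)) \<union> (S u \<inter> (S v \<inter> U))" by blast
    moreover have "(S u \<inter> (U - S v)) \<inter> (S u \<inter> (S v \<inter> U)) = {}" by blast
    ultimately have "gain S U u = gain S (U - S v) u + card (S u \<inter> (S v \<inter> U))"
      using fin by (simp add: gain_def card_Un_disjoint)
    then show "gain S U u - gain S (U - S v) u = card (S u \<inter> (S v \<inter> U))"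
      "gain S (U - S v) u \<le> gain S U u" by auto
  qed
  have "S v \<inter> U = (\<Union>u\<in>K. S u \<inter> (S v \<inter> U))" using cover by blast
  then have "gain S U v \<le> (\<Sum>u\<in>K. card (S u \<inter> (S v \<inter> U)))"
    using card_UN_le[OF fin(2), of "\<lambda>u. S u \<inter> (S v \<inter> U)"] by (simp add: gain_def)
  then have "1 \<le> (\<Sum>u\<in>K. real (card (S u \<inter> (S v \<inter> U)))) / real (gain S U v)"
    using pos by (simp add: field_simps flip: of_nat_sum)
  also have "\<dots> = (\<Sum>u\<in>K. real (gain S U u - gain S (U - S v) u) / real (gain S U v))"
    by (simp add: split sum_divide_distrib)
  also have "\<dots> \<le> (\<Sum>u\<in>K. harm (gain S U u) - harm (gain S (U - S v) u))"
    using harm_diff_ge[OF le max pos] by (intro sum_mono) auto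
  finally show ?thesis by (simp add: sum_subtractf)
qed

section \<open>Greedy rounds and their invariant\<close>

definition uncovered :: "nat \<Rightarrow> (nat \<Rightarrow> nat set) \<Rightarrow> nat set \<Rightarrow> nat set" where
  "uncovered n S D = {..<n} - (\<Union>v\<in>D. S v)"

definition covers :: "nat \<Rightarrow> (nat \<Rightarrow> nat set) \<Rightarrow> nat set \<Rightarrow> bool" where
  "covers n S D \<longleftrightarrow> D \<subseteq> {..<n} \<and> {..<n} \<subseteq> (\<Union>v\<in>D. S v)"

text \<open>A relation and not a function, so that ties are left to the scan order of the program.
  The first alternative is the idle round that makes a fixed number of rounds possible.\<close>

definition greedy_step :: "nat \<Rightarrow> (nat \<Rightarrow> nat set) \<Rightarrow> nat set \<Rightarrow> nat set \<Rightarrow> bool" where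
  "greedy_step n S D D' \<longleftrightarrow>
     (let g = gain S (uncovered n S D) in
       (\<forall>v<n. g v = 0) \<and> D' = D \<or>
       (\<exists>v<n. 0 < g v \<and> (\<forall>u<n. g u \<le> g v) \<and> D' = insert v D))"

text \<open>\<open>k\<close> is the number of rounds still to come, so coverage is complete at
  \<open>k = 0\<close>. The cover \<open>K\<close> is quantified inside because the one to compare
  with, the support of an optimal function, is known only to the analysis. If there is no cover,
  only \<open>D \<subseteq> {..<n}\<close> remains.\<close>

definition greedy_inv :: "nat \<Rightarrow> (nat \<Rightarrow> nat set) \<Rightarrow> nat \<Rightarrow> nat set \<Rightarrow> bool" where
  "greedy_inv n S k D \<longleftrightarrow> D \<subseteq> {..<n} \<and>
     (\<forall>K. covers n S K \<longrightarrow> card (uncovered n S D) \<le> k \<and>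
        real (card D) + (\<Sum>u\<in>K. harm (gain S (uncovered n S D) u)) \<le> (\<Sum>u\<in>K. harm (card (S u))))"

lemma finite_uncovered [simp]: "finite (uncovered n S D)"
  by (simp add: uncovered_def)

lemma greedy_inv_start:
  assumes "\<And>v. v < n \<Longrightarrow> S v \<subseteq> {..<n}"
  shows "greedy_inv n S n {}"
proof -
  have "gain S {..<n} u = card (S u)" if "u < n" for u
    using assms[OF that] by (simp add: gain_def Int_absorb2)
  then show ?thesis
    by (auto simp: greedy_inv_def uncovered_def covers_def intro!: sum_mono)
qed

lemma greedy_inv_step:
  assumes inv: "greedy_inv n S (Suc k) D" and step: "greedy_step n S D D'"
  shows "greedy_inv n S k D'"
proof -
  let ?U = "uncovered n S D"
  have D: "D \<subseteq> {..<n}" and finD: "finite D"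
    using inv by (auto simp: greedy_inv_def intro: finite_subset)
  consider (stuck) "\<forall>v<n. gain S ?U v = 0" "D' = D"
    | (pick) v where "v < n" "0 < gain S ?U v" "\<forall>u<n. gain S ?U u \<le> gain S ?U v" "D' = insert v D"
    using step by (auto simp: greedy_step_def Let_def)
  then show ?thesis
  proof cases
    case stuck
    \<comment> \<open>An uncovered point lies in some \<open>S v\<close> with \<open>v\<close> in
      \<open>K\<close>, and the gain of this \<open>v\<close> would be positive.\<close>
    have "?U = {}" if "covers n S K" for K
    proof -
      have "S v \<inter> ?U = {}" if "v < n" for v
        using stuck that by (auto simp: gain_def)
      moreover have "?U \<subseteq> (\<Union>v\<in>K. S v)" "K \<subseteq> {..<n}"
        using that by (auto simp: covers_def uncovered_def)
      ultimately show ?thesis by blast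
    qed
    then show ?thesis
      using inv stuck by (auto simp: greedy_inv_def)
  next
    case pick
    have U': "uncovered n S D' = ?U - S v"
      using pick by (auto simp: uncovered_def)
    have less: "card (?U - S v) < card ?U"
    proof (rule psubset_card_mono)
      have "S v \<inter> ?U \<noteq> {}"
        using pick(2) by (auto simp: gain_def)
      then show "?U - S v \<subset> ?U" by blast
    qed simp
    have "card (uncovered n S D') \<le> k \<and>
       real (card D') + (\<Sum>u\<in>K. harm (gain S (uncovered n S D') u)) \<le> (\<Sum>u\<in>K. harm (card (S u)))"
      if K: "covers n S K" for K
    proof -
      have "1 + (\<Sum>u\<in>K. harm (gain S (?U - S v) u)) \<le> (\<Sum>u\<in>K. harm (gain S ?U u) :: real)"
        using K pick by (intro greedy_potential_decrease)
          (auto simp: covers_def uncovered_def intro: finite_subset)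
      moreover have "real (card D') \<le> real (card D) + 1"
        using pick(4) finD by (simp add: card_insert_if)
      moreover have "card ?U \<le> Suc k"
        "real (card D) + (\<Sum>u\<in>K. harm (gain S ?U u)) \<le> (\<Sum>u\<in>K. harm (card (S u)))"
        using inv K by (auto simp: greedy_inv_def)
      ultimately show ?thesis
        using less by (simp add: U')
    qed
    then show ?thesis
      using D pick by (auto simp: greedy_inv_def)
  qed
qed

lemma greedy_inv_final:
  assumes "greedy_inv n S 0 D" "covers n S K"
  shows "covers n S D" "real (card D) \<le> (\<Sum>u\<in>K. harm (card (S u)))"
proof -
  have "card (uncovered n S D) = 0" and D: "D \<subseteq> {..<n}"
    and le: "real (card D) + (\<Sum>u\<in>K. harm (gain S (uncovered n S D) u)) \<le> (\<Sum>u\<in>K. harm (card (S u)))"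
    using assms by (auto simp: greedy_inv_def)
  then have "uncovered n S D = {}" by simp
  then show "covers n S D"
    using D by (auto simp: covers_def uncovered_def)
  have "0 \<le> (\<Sum>u\<in>K. harm (gain S (uncovered n S D) u) :: real)"
    by (intro sum_nonneg harm_nonneg)
  then show "real (card D) \<le> (\<Sum>u\<in>K. harm (card (S u)))"
    using le by linarith
qed


section \<open>Total correctness with time bounds\<close>

text \<open>An upper bound in place of the exact time lets both branches of a test, and all
  iterations of a loop, share one budget. The postcondition can itself be a \<open>runs\<close>
  statement, which handles sequencing.\<close>

definition runs ::
  "com \<Rightarrow> (nat \<Rightarrow> nat) \<Rightarrow> (nat \<Rightarrow> nat) \<Rightarrow> nat \<Rightarrow> ((nat \<Rightarrow> nat) \<Rightarrow> (nat \<Rightarrow> nat) \<Rightarrow> bool) \<Rightarrow> bool" where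
  "runs c r m T Q \<longleftrightarrow> (\<exists>t r' m'. exec c (r, m) t (r', m') \<and> t \<le> T \<and> Q r' m')"

lemma runs_basic:
  assumes "1 \<le> T"
  shows "Q (r(i := k)) m \<Longrightarrow> runs (Const i k) r m T Q"
    and "Q (r(i := r j + r l)) m \<Longrightarrow> runs (Add i j l) r m T Q"
    and "Q (r(i := r j - r l)) m \<Longrightarrow> runs (Sub i j l) r m T Q"
    and "Q (r(i := m (r j))) m \<Longrightarrow> runs (Load i j) r m T Q"
    and "Q r (m(r i := r j)) \<Longrightarrow> runs (Store i j) r m T Q"
    and "Q r m \<Longrightarrow> runs Skip r m T Q"
  unfolding runs_def using assms by (iprover intro: exec.intros)+

lemma runs_Seq:
  assumes "runs c1 r m T1 (\<lambda>r' m'. runs c2 r' m' T2 Q)" "T1 + T2 \<le> T"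
  shows "runs (Seq c1 c2) r m T Q"
proof -
  obtain t1 r1 m1 t2 r2 m2 where "exec c1 (r, m) t1 (r1, m1)" "t1 \<le> T1"
      "exec c2 (r1, m1) t2 (r2, m2)" "t2 \<le> T2" "Q r2 m2"
    using assms(1) unfolding runs_def by blast
  then show ?thesis
    using assms(2) exec.Seq[of c1 "(r, m)" t1 "(r1, m1)" c2 t2 "(r2, m2)"]
    unfolding runs_def by (intro exI[of _ "t1 + t2"] exI[of _ r2] exI[of _ m2]) simp
qed

text \<open>Repeated application executes straight-line code symbolically, at one unit of budget per
  instruction.\<close>

lemma runs_Seq_basic:
  assumes "1 \<le> T"
  shows "runs c (r(i := k)) m (T - 1) Q \<Longrightarrow> runs (Seq (Const i k) c) r m T Q"
    and "runs c (r(i := r j + r l)) m (T - 1) Q \<Longrightarrow> runs (Seq (Add i j l) c) r m T Q"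
    and "runs c (r(i := r j - r l)) m (T - 1) Q \<Longrightarrow> runs (Seq (Sub i j l) c) r m T Q"
    and "runs c (r(i := m (r j))) m (T - 1) Q \<Longrightarrow> runs (Seq (Load i j) c) r m T Q"
    and "runs c r (m(r i := r j)) (T - 1) Q \<Longrightarrow> runs (Seq (Store i j) c) r m T Q"
  by (rule runs_Seq[where ?T1.0 = 1 and ?T2.0 = "T - 1"], rule runs_basic; use assms in simp)+

lemma runs_IfNZ:
  assumes "1 \<le> T" "r i \<noteq> 0 \<Longrightarrow> runs c1 r m (T - 1) Q" "r i = 0 \<Longrightarrow> runs c2 r m (T - 1) Q"
  shows "runs (IfNZ i c1 c2) r m T Q"
proof (cases "r i = 0")
  case True
  then obtain t r' m' where "exec c2 (r, m) t (r', m')" "t \<le> T - 1" "Q r' m'"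
    using assms(3) by (auto simp: runs_def)
  then show ?thesis
    using assms(1) True exec.IfFalse[of "(r, m)" i c2 t "(r', m')" c1]
    unfolding runs_def by (intro exI[of _ "1 + t"] exI[of _ r'] exI[of _ m']) auto
next
  case False
  then obtain t r' m' where "exec c1 (r, m) t (r', m')" "t \<le> T - 1" "Q r' m'"
    using assms(2) by (auto simp: runs_def)
  then show ?thesis
    using assms(1) False exec.IfTrue[of "(r, m)" i c1 t "(r', m')" c2]
    unfolding runs_def by (intro exI[of _ "1 + t"] exI[of _ r'] exI[of _ m']) auto
qed

lemma runs_mono:
  assumes "runs c r m T Q" "T \<le> T'" "\<And>r' m'. Q r' m' \<Longrightarrow> Q' r' m'"
  shows "runs c r m T' Q'"
  using assms unfolding runs_def by (blast intro: order_trans)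

lemmas runs_intros = runs_Seq_basic runs_basic

text \<open>Register 15 is expected to contain the constant 1.\<close>

definition Down :: "nat \<Rightarrow> com \<Rightarrow> com" where
  "Down i c = WhileNZ i (Seq (Sub i i 15) c)"

text \<open>The invariant is indexed by the counter. The body sees the counter already decremented,
  so it treats index \<open>j\<close> while leading from \<open>I (Suc j)\<close> to
  \<open>I j\<close>. The 2 added to \<open>T\<close> pays for test and decrement, the final 1 for
  the failing test.\<close>

lemma runs_Down:
  assumes "I k r m" "k * (T + 2) + 1 \<le> T'"
    and inv: "\<And>j r m. I j r m \<Longrightarrow> r i = j \<and> r 15 = 1"
    and step: "\<And>j r m. j < k \<Longrightarrow> I (Suc j) r m \<Longrightarrow> runs c (r(i := j)) m T (I j)"
    and final: "\<And>r m. I 0 r m \<Longrightarrow> Q r m"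
  shows "runs (Down i c) r m T' Q"
proof -
  have "j \<le> k \<Longrightarrow> I j r m \<Longrightarrow> runs (Down i c) r m (j * (T + 2) + 1) (I 0)" for j r m
  proof (induction j arbitrary: r m)
    case 0
    then show ?case
      using inv[OF 0(2)] exec.WhileFalse[of "(r, m)" i] unfolding runs_def Down_def by fastforce
  next
    case (Suc j)
    then obtain t r' m' where body: "exec c (r(i := j), m) t (r', m')" "t \<le> T" "I j r' m'"
      using step[of j r m] by (auto simp: runs_def)
    then obtain t' r'' m'' where rest: "exec (Down i c) (r', m') t' (r'', m'')"
        "t' \<le> j * (T + 2) + 1" "I 0 r'' m''"
      using Suc.IH[of r' m'] Suc.prems(1) by (auto simp: runs_def)
    have r: "r i = Suc j" "r 15 = 1"
      using inv[OF Suc.prems(2)] by auto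
    then have "exec (Sub i i 15) (r, m) 1 (r(i := j), m)"
      using exec.Sub[of i i 15 r m] by simp
    then have "exec (Seq (Sub i i 15) c) (r, m) (1 + t) (r', m')"
      using body(1) exec.Seq by blast
    then have "exec (Down i c) (r, m) (1 + (1 + t) + t') (r'', m'')"
      using rest(1) r exec.WhileTrue[of "(r, m)" i "Seq (Sub i i 15) c" "1 + t" "(r', m')"]
      unfolding Down_def by simp
    moreover have "1 + (1 + t) + t' \<le> Suc j * (T + 2) + 1"
      using body(2) rest(2) by simp
    ultimately show ?case
      using rest(3) unfolding runs_def by blast
  qed
  from runs_mono[OF this[OF order_refl assms(1)] assms(2) final] show ?thesis .
qed


section \<open>The greedy program\<close>

text \<open>Registers 2 and 4 hold the base addresses of the output block and of the block of
  counters. The zero in register 10 turns \<open>Add i j 10\<close> into a copy instruction.\<close>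

definition regs :: "nat \<Rightarrow> (nat \<Rightarrow> nat) \<Rightarrow> bool" where
  "regs n r \<longleftrightarrow> r 0 = n \<and> r 2 = n * n \<and> r 4 = n * n + n \<and> r 10 = 0 \<and> r 15 = 1"

definition matrix :: "nat \<Rightarrow> (nat \<Rightarrow> nat set) \<Rightarrow> (nat \<Rightarrow> nat) \<Rightarrow> bool" where
  "matrix n S m \<longleftrightarrow> (\<forall>v<n. \<forall>w<n. m (v * n + w) = of_bool (w \<in> S v))"

text \<open>
  Behind the matrix the memory holds the output and then, for each vertex, the number of times it
  has been covered.
\<close>

definition greedy_memory ::
  "nat \<Rightarrow> (nat \<Rightarrow> nat set) \<Rightarrow> nat \<Rightarrow> nat set \<Rightarrow> (nat \<Rightarrow> nat) \<Rightarrow> bool" where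
  "greedy_memory n S out D m \<longleftrightarrow> matrix n S m \<and>
     (\<forall>v<n. m (n * n + v) = (if v \<in> D then out else 0)) \<and>
     (\<forall>w<n. m (n * n + n + w) = 0 \<longleftrightarrow> w \<in> uncovered n S D)"

lemma matrix_index_less: "v * n + w < n * n" if "v < n" "w < n" for v w n :: nat
proof -
  have "v * n + w < Suc v * n" using that by simp
  also have "\<dots> \<le> n * n" using that by (intro mult_right_mono) auto
  finally show ?thesis .
qed

text \<open>Loops count down, so a partial count covers the indices from \<open>k\<close> upwards;
  this is its update by one iteration.\<close>

lemma card_Collect_ge_Suc:
  fixes X :: "nat set"
  assumes "finite X"
  shows "card {w \<in> X. k \<le> w} = of_bool (k \<in> X) + card {w \<in> X. Suc k \<le> w}"
proof (cases "k \<in> X")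
  case True
  then have "{w \<in> X. k \<le> w} = insert k {w \<in> X. Suc k \<le> w}" by auto
  then show ?thesis using assms True by simp
next
  case False
  then have "{w \<in> X. k \<le> w} = {w \<in> X. Suc k \<le> w}"
    by (metis (lifting) Suc_leD Suc_leI le_neq_implies_less)
  then show ?thesis using False by simp
qed

text \<open>Register 6 points to the row of the vertex; the gain is accumulated in register 9.\<close>

definition count_gain :: com where
  "count_gain = Down 7 (Seq (Add 11 6 7) (Seq (Load 11 11) (Seq (Add 12 4 7) (Seq (Load 12 12)
     (Seq (Sub 11 11 12) (Add 9 9 11))))))"

lemma runs_count_gain:
  assumes mem: "greedy_memory n S out D m"
    and r: "regs n r" "r 7 = n" "r 6 = v * n" "r 9 = 0" and v: "v < n"
  shows "runs count_gain r m (n * 8 + 1) (\<lambda>r' m'. m' = m \<and>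
     r' 9 = gain S (uncovered n S D) v \<and> (\<forall>i. i \<notin> {7, 9, 11, 12} \<longrightarrow> r' i = r i))"
proof -
  let ?X = "S v \<inter> uncovered n S D"
  define I where "I k r' m' \<longleftrightarrow> m' = m \<and> r' 7 = k \<and> r' 9 = card {w \<in> ?X. k \<le> w} \<and>
    (\<forall>i. i \<notin> {7, 9, 11, 12} \<longrightarrow> r' i = r i)" for k r' m'
  show ?thesis
    unfolding count_gain_def
  proof (rule runs_Down[where I = I and k = n and T = 6])
    have "{w \<in> ?X. n \<le> w} = {}" by (auto simp: uncovered_def)
    then show "I n r m"
      using r by (simp add: I_def del: Collect_empty_eq)
  next
    fix j r' m' assume j: "j < n" and I: "I (Suc j) r' m'"
    \<comment> \<open>The matrix entry is 0 or 1, so truncated subtraction of the cover count leaves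
      1 exactly when the entry is 1 and the count is 0.\<close>
    have "m (v * n + j) - m (n * n + n + j) = of_bool (j \<in> ?X)"
    proof -
      have "m (v * n + j) = of_bool (j \<in> S v)"
        "m (n * n + n + j) = 0 \<longleftrightarrow> j \<in> uncovered n S D"
        using mem v j by (auto simp: greedy_memory_def matrix_def)
      then show ?thesis by auto
    qed
    moreover have "card {w \<in> ?X. j \<le> w} = of_bool (j \<in> ?X) + card {w \<in> ?X. Suc j \<le> w}"
      by (rule card_Collect_ge_Suc) simp
    ultimately have "card {w \<in> ?X. j \<le> w} =
        card {w \<in> ?X. Suc j \<le> w} + (m (v * n + j) - m (n * n + n + j))"
      by linarith
    with I r show "runs (Seq (Add 11 6 7) (Seq (Load 11 11) (Seq (Add 12 4 7) (Seq (Load 12 12)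
     (Seq (Sub 11 11 12) (Add 9 9 11)))))) (r'(7 := j)) m' 6 (I j)"
      by (intro runs_intros) (simp_all add: I_def regs_def del: of_bool_eq)
  qed (use r in \<open>auto simp: I_def regs_def gain_def Int_def\<close>)
qed

text \<open>
  The best gain found so far is in register 8, its vertex in register 13 and the address of the
  row of this vertex in register 14.
\<close>

definition scan :: com where
  "scan = Down 5 (Seq (Sub 6 6 0) (Seq (Const 9 0) (Seq (Add 7 0 10) (Seq count_gain
     (Seq (Sub 11 9 8) (IfNZ 11 (Seq (Add 8 9 10) (Seq (Add 13 5 10) (Add 14 6 10))) Skip))))))"

lemma runs_scan:
  assumes mem: "greedy_memory n S out D m"
    and r: "regs n r" "r 5 = n" "r 6 = n * n" "r 8 = 0"
  shows "runs scan r m (n * (n * 8 + 11) + 1) (\<lambda>r' m'. m' = m \<and>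
     (\<forall>u<n. gain S (uncovered n S D) u \<le> r' 8) \<and>
     (r' 8 \<noteq> 0 \<longrightarrow> r' 13 < n \<and> r' 14 = r' 13 * n \<and> gain S (uncovered n S D) (r' 13) = r' 8) \<and>
     regs n r' \<and> r' 3 = r 3)"
proof -
  let ?g = "gain S (uncovered n S D)"
  \<comment> \<open>The row address \<open>k * n\<close> starts at \<open>n * n\<close> and is
    lowered by \<open>n\<close> before each use. A zero in register 8 means that no candidate has
    been recorded yet.\<close>
  define I where "I k r' m' \<longleftrightarrow> m' = m \<and> r' 5 = k \<and> r' 6 = k * n \<and>
    (\<forall>u<n. k \<le> u \<longrightarrow> ?g u \<le> r' 8) \<and>
    (r' 8 \<noteq> 0 \<longrightarrow> r' 13 < n \<and> r' 14 = r' 13 * n \<and> ?g (r' 13) = r' 8) \<and>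
    regs n r' \<and> r' 3 = r 3" for k r' m'
  show ?thesis
    unfolding scan_def
  proof (rule runs_Down[where I = I and k = n and T = "n * 8 + 9"])
    fix j r' m' assume j: "j < n" and I: "I (Suc j) r' m'"
    let ?r = "r'(5 := j, 6 := j * n, 9 := 0, 7 := n)"
    have upd: "r'(5 := j, 6 := r' 6 - r' 0, 9 := 0, 7 := r' 0 + r' 10) = ?r"
      using I by (auto simp: I_def regs_def)
    have le: "(\<forall>u<n. j \<le> u \<longrightarrow> ?g u \<le> b) \<longleftrightarrow> ?g j \<le> b \<and> (\<forall>u<n. Suc j \<le> u \<longrightarrow> ?g u \<le> b)" for b
      using j by (metis Suc_leD Suc_leI le_neq_implies_less order_refl)
    have "runs (Seq count_gain (Seq (Sub 11 9 8)
        (IfNZ 11 (Seq (Add 8 9 10) (Seq (Add 13 5 10) (Add 14 6 10))) Skip))) ?r m' (n * 8 + 6) (I j)"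
    proof (rule runs_Seq)
      show "runs count_gain ?r m' (n * 8 + 1) (\<lambda>r'' m''.
        runs (Seq (Sub 11 9 8) (IfNZ 11 (Seq (Add 8 9 10) (Seq (Add 13 5 10) (Add 14 6 10))) Skip))
          r'' m'' 5 (I j))"
      proof (rule runs_mono[OF runs_count_gain])
        fix r'' m'' assume "m'' = m' \<and> r'' 9 = ?g j \<and> (\<forall>i. i \<notin> {7, 9, 11, 12} \<longrightarrow> r'' i = ?r i)"
        then have "m'' = m" "r'' 9 = ?g j" "r'' 5 = j" "r'' 6 = j * n" "r'' 8 = r' 8"
          "r'' 13 = r' 13" "r'' 14 = r' 14" "r'' 3 = r 3" "regs n r''"
          using I by (auto simp: I_def regs_def)
        \<comment> \<open>The truncated difference of registers 9 and 8 is nonzero exactly when the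
          new gain is strictly larger, and so decides whether to replace the candidate.\<close>
        with I j show "runs (Seq (Sub 11 9 8)
            (IfNZ 11 (Seq (Add 8 9 10) (Seq (Add 13 5 10) (Add 14 6 10))) Skip)) r'' m'' 5 (I j)"
          by (intro runs_intros runs_IfNZ) (auto simp: I_def regs_def le)
      qed (use mem I j in \<open>auto simp: I_def regs_def\<close>)
    qed simp
    then have "runs (Seq count_gain (Seq (Sub 11 9 8)
        (IfNZ 11 (Seq (Add 8 9 10) (Seq (Add 13 5 10) (Add 14 6 10))) Skip)))
        (r'(5 := j, 6 := r' 6 - r' 0, 9 := 0, 7 := r' 0 + r' 10)) m' (n * 8 + 6) (I j)"
      unfolding upd .
    then show "runs (Seq (Sub 6 6 0) (Seq (Const 9 0) (Seq (Add 7 0 10) (Seq count_gain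
      (Seq (Sub 11 9 8) (IfNZ 11 (Seq (Add 8 9 10) (Seq (Add 13 5 10) (Add 14 6 10))) Skip))))))
      (r'(5 := j)) m' (n * 8 + 9) (I j)"
      by (intro runs_Seq_basic) (simp_all add: fun_upd_twist add.commute)
  qed (use r in \<open>auto simp: I_def regs_def\<close>)
qed

definition mark :: "nat \<Rightarrow> com" where
  "mark out = Seq (Const 11 out) (Seq (Add 12 2 13) (Seq (Store 12 11) (Seq (Add 7 0 10)
     (Down 7 (Seq (Add 11 14 7) (Seq (Load 11 11) (Seq (Add 12 4 7) (Seq (Load 9 12)
        (Seq (Add 9 9 11) (Store 12 9))))))))))"

lemma runs_mark:
  assumes mem: "greedy_memory n S out D m"
    and r: "regs n r" "r 14 = r 13 * n" "r 13 < n"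
  shows "runs (mark out) r m (n * 8 + 5) (\<lambda>r' m'.
     greedy_memory n S out (insert (r 13) D) m' \<and> regs n r' \<and> r' 3 = r 3)"
proof -
  let ?v = "r 13" and ?m = "m(n * n + r 13 := out)"
  let ?r = "r(11 := out, 12 := n * n + r 13, 7 := n)"
  \<comment> \<open>Only counters are written in the loop, so everything below
    \<open>n * n + n\<close>, in particular the matrix row being read, stays as in
    \<open>?m\<close>.\<close>
  define I where "I k r' m' \<longleftrightarrow> r' 7 = k \<and>
    (\<forall>a<n * n + n. m' a = ?m a) \<and>
    (\<forall>w<n. m' (n * n + n + w) = ?m (n * n + n + w) + of_bool (k \<le> w \<and> w \<in> S ?v)) \<and>
    regs n r' \<and> r' 3 = r 3 \<and> r' 14 = r 14" for k r' m'
  have "runs (Down 7 (Seq (Add 11 14 7) (Seq (Load 11 11) (Seq (Add 12 4 7) (Seq (Load 9 12)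
        (Seq (Add 9 9 11) (Store 12 9))))))) ?r ?m (n * 8 + 1) (\<lambda>r' m'.
     greedy_memory n S out (insert (r 13) D) m' \<and> regs n r' \<and> r' 3 = r 3)"
  proof (rule runs_Down[where I = I and k = n and T = 6])
    fix j r' m' assume j: "j < n" and I: "I (Suc j) r' m'"
    define b :: nat where "b = of_bool (j \<in> S ?v)"
    have "m' (?v * n + j) = b"
    proof -
      have "?v * n + j < n * n"
        using j r by (intro matrix_index_less)
      then have "m' (?v * n + j) = m (?v * n + j)"
        using I by (simp add: I_def)
      then show ?thesis
        using mem j r by (simp add: greedy_memory_def matrix_def b_def)
    qed
    moreover have "r' 14 = ?v * n" "r' 4 = n * n + n"
      using I r by (simp_all add: I_def regs_def)
    moreover have "I j (r'(7 := j, 11 := x, 12 := y, 9 := z))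
        (m'(n * n + n + j := m' (n * n + n + j) + b))" for x y z
    proof -
      have "j \<le> w \<longleftrightarrow> Suc j \<le> w" if "w \<noteq> j" for w
        using that by linarith
      then show ?thesis
        using I j unfolding I_def regs_def b_def by simp
    qed
    ultimately show "runs (Seq (Add 11 14 7) (Seq (Load 11 11) (Seq (Add 12 4 7) (Seq (Load 9 12)
        (Seq (Add 9 9 11) (Store 12 9)))))) (r'(7 := j)) m' 6 (I j)"
      by (intro runs_intros) simp_all
  next
    fix r' m' assume I: "I 0 r' m'"
    have "matrix n S m'"
      unfolding matrix_def
    proof (intro allI impI)
      fix v w assume vw: "v < n" "w < n"
      have "v * n + w < n * n" by (rule matrix_index_less[OF vw])
      then have "m' (v * n + w) = m (v * n + w)"
        using I by (simp add: I_def)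
      then show "m' (v * n + w) = of_bool (w \<in> S v)"
        using mem vw by (simp add: greedy_memory_def matrix_def)
    qed
    \<comment> \<open>This matches the counters: a sum of naturals is zero only if the old count and
      the added matrix entry both are.\<close>
    have "uncovered n S (insert ?v D) = uncovered n S D - S ?v"
      by (auto simp: uncovered_def)
    show "greedy_memory n S out (insert (r 13) D) m' \<and> regs n r' \<and> r' 3 = r 3"
    proof -
      have "m' (n * n + u) = (if u = ?v then out else m (n * n + u))" if "u < n" for u
        using I that by (simp add: I_def)
      moreover have "m' (n * n + n + w) = m (n * n + n + w) + of_bool (w \<in> S ?v)" if "w < n" for w
        using I that r(3) by (simp add: I_def)
      ultimately show ?thesis
        using \<open>matrix n S m'\<close> \<open>uncovered n S (insert ?v D) = uncovered n S D - S ?v\<close> mem I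
        unfolding greedy_memory_def by (simp add: I_def)
    qed
  qed (use r in \<open>auto simp: I_def regs_def\<close>)
  then show ?thesis
    using r unfolding mark_def by (intro runs_Seq_basic) (simp_all add: regs_def)
qed

definition greedy_round :: "nat \<Rightarrow> com" where
  "greedy_round out = Seq (Const 8 0) (Seq (Add 5 0 10) (Seq (Add 6 2 10)
     (Seq scan (IfNZ 8 (mark out) Skip))))"

lemma runs_greedy_round:
  assumes mem: "greedy_memory n S out D m" and r: "regs n r"
  shows "runs (greedy_round out) r m (n * (n * 8 + 19) + 10) (\<lambda>r' m'.
     \<exists>D'. greedy_step n S D D' \<and> greedy_memory n S out D' m' \<and> regs n r' \<and> r' 3 = r 3)"
    (is "runs _ _ _ _ ?Q")
proof -
  let ?r = "r(8 := 0, 5 := n, 6 := n * n)"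
  let ?g = "gain S (uncovered n S D)"
  have "runs (Seq scan (IfNZ 8 (mark out) Skip)) ?r m (n * (n * 8 + 19) + 7) ?Q"
  proof (rule runs_Seq)
    show "runs scan ?r m (n * (n * 8 + 11) + 1) (\<lambda>r' m'.
        runs (IfNZ 8 (mark out) Skip) r' m' (n * 8 + 6) ?Q)"
    proof (rule runs_mono[OF runs_scan[OF mem]])
      fix r' m' assume *: "m' = m \<and> (\<forall>u<n. ?g u \<le> r' 8) \<and>
        (r' 8 \<noteq> 0 \<longrightarrow> r' 13 < n \<and> r' 14 = r' 13 * n \<and> ?g (r' 13) = r' 8) \<and>
        regs n r' \<and> r' 3 = ?r 3"
      \<comment> \<open>Register 8 is both the maximal gain and the flag: zero is the idle
        alternative of \<open>greedy_step\<close>.\<close>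
      show "runs (IfNZ 8 (mark out) Skip) r' m' (n * 8 + 6) ?Q"
      proof (rule runs_IfNZ)
        assume nz: "r' 8 \<noteq> 0"
        have "greedy_step n S D (insert (r' 13) D)"
          using * nz by (auto simp: greedy_step_def Let_def)
        then show "runs (mark out) r' m' (n * 8 + 6 - 1) ?Q"
          using * nz mem by (intro runs_mono[OF runs_mark[of n S out D]]) auto
      next
        assume "r' 8 = 0"
        then have "greedy_step n S D D"
          using * by (auto simp: greedy_step_def)
        then show "runs Skip r' m' (n * 8 + 6 - 1) ?Q"
          using * mem by (intro runs_basic) auto
      qed simp
    qed (use r in \<open>auto simp: regs_def\<close>)
  qed (simp add: algebra_simps)
  then show ?thesis
    using r unfolding greedy_round_def by (intro runs_Seq_basic) (simp_all add: regs_def add.commute)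
qed

section \<open>Initialisation of registers and matrix\<close>

lemma matrix_index_eq_iff:
  "v * n + w = v' * n + w' \<longleftrightarrow> v = v' \<and> w = w'" if "w < n" "w' < n" for v w v' w' n :: nat
proof
  assume eq: "v * n + w = v' * n + w'"
  have "(v * n + w) div n = v" "(v' * n + w') div n = v'"
    using that by auto
  then show "v = v' \<and> w = w'" using eq by auto
qed auto

text \<open>Writes \<open>diag\<close> to the diagonal of the matrix, turning open into closed neighbourhoods.\<close>

definition setup_memory :: "nat \<Rightarrow> com" where
  "setup_memory diag = Seq (Const 15 1) (Seq (Add 3 0 10) (Seq (Down 3 (Add 2 2 0))
     (Seq (Add 4 2 0) (Seq (Const 5 diag) (Seq (Add 3 0 10) (Seq (Add 6 2 10)
       (Down 3 (Seq (Sub 6 6 0) (Seq (Add 7 6 3) (Store 7 5))))))))))"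

text \<open>The two kinds of neighbourhood differ only on the diagonal, so the entries assumed in
  advance are those off it and \<open>diag\<close> supplies the rest. One program text thus serves
  both kinds.\<close>

lemma runs_setup_memory:
  assumes r: "r 0 = n" "\<And>i. i \<noteq> 0 \<Longrightarrow> r i = 0"
    and m: "\<And>v w. v < n \<Longrightarrow> w < n \<Longrightarrow> v \<noteq> w \<Longrightarrow> m (v * n + w) = of_bool (w \<in> S v)"
      "\<And>a. n * n \<le> a \<Longrightarrow> m a = 0"
    and diag: "\<And>v. v < n \<Longrightarrow> diag = of_bool (v \<in> S v)"
  shows "runs (setup_memory diag) r m (n * 8 + 8) (\<lambda>r' m'. regs n r' \<and> greedy_memory n S out {} m')"
    (is "runs _ _ _ _ ?Q")
proof -
  let ?loop2 = "Down 3 (Seq (Sub 6 6 0) (Seq (Add 7 6 3) (Store 7 5)))"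
  let ?rest = "Seq (Add 4 2 0) (Seq (Const 5 diag) (Seq (Add 3 0 10) (Seq (Add 6 2 10) ?loop2)))"
  have loop2: "runs ?loop2 r m (n * 5 + 1) ?Q"
    if "regs n r" "r 3 = n" "r 5 = diag" "r 6 = n * n" for r
  proof -
    \<comment> \<open>Off-diagonal entries are correct throughout, diagonal ones from
      \<open>k\<close> on. That a write disturbs no other entry is the injectivity of row-major
      addressing.\<close>
    define I where "I k r' m' \<longleftrightarrow> regs n r' \<and> r' 3 = k \<and> r' 5 = diag \<and> r' 6 = k * n \<and>
      (\<forall>a\<ge>n * n. m' a = 0) \<and>
      (\<forall>v<n. \<forall>w<n. (v = w \<longrightarrow> k \<le> v) \<longrightarrow> m' (v * n + w) = of_bool (w \<in> S v))"
      for k r' and m' :: "nat \<Rightarrow> nat"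
    show ?thesis
    proof (rule runs_Down[where I = I and k = n and T = 3])
      show "I n r m"
        using that m by (auto simp: I_def)
    next
      fix j r' m' assume j: "j < n" and I: "I (Suc j) r' m'"
      have lt: "j * n + j < n * n" using j by (rule matrix_index_less) (rule j)
      have "(m'(j * n + j := diag)) (v * n + w) = of_bool (w \<in> S v)"
        if "v < n" "w < n" "v = w \<longrightarrow> j \<le> v" for v w
      proof (cases "v = j \<and> w = j")
        case True
        then show ?thesis using diag[OF j] by simp
      next
        case False
        then have "v * n + w \<noteq> j * n + j"
          using matrix_index_eq_iff[of w n j v j] that j by simp
        moreover have "v = w \<longrightarrow> Suc j \<le> v" using False that by auto
        ultimately show ?thesis using I that by (simp add: I_def)
      qed
      then have "I j (r'(3 := j, 6 := j * n, 7 := j * n + j)) (m'(j * n + j := diag))"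
        using I lt unfolding I_def regs_def by simp
      moreover have "r' 6 = n + j * n" "r' 5 = diag" "r' 0 = n"
        using I by (simp_all add: I_def regs_def)
      ultimately show "runs (Seq (Sub 6 6 0) (Seq (Add 7 6 3) (Store 7 5))) (r'(3 := j)) m' 3 (I j)"
        by (intro runs_intros) simp_all
    next
      fix r' m' assume "I 0 r' m'"
      then show "?Q r' m'"
        by (auto simp: I_def greedy_memory_def matrix_def uncovered_def)
    qed (auto simp: I_def regs_def)
  qed
  have "runs (Seq (Down 3 (Add 2 2 0)) ?rest) (r(15 := 1, 3 := n)) m (n * 8 + 6) ?Q"
  proof (rule runs_Seq)
    \<comment> \<open>The square is formed by n-fold addition; the equation avoids truncated
      subtraction.\<close>
    define I where "I k r' m' \<longleftrightarrow> m' = m \<and> r' 3 = k \<and> r' 2 + k * n = n * n \<and> r' 0 = n \<and>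
      r' 10 = 0 \<and> r' 15 = 1" for k and r' m' :: "nat \<Rightarrow> nat"
    show "runs (Down 3 (Add 2 2 0)) (r(15 := 1, 3 := n)) m (n * 3 + 1)
        (\<lambda>r' m'. runs ?rest r' m' (n * 5 + 5) ?Q)"
    proof (rule runs_Down[where I = I and k = n and T = 1])
      fix j r' m' assume "I (Suc j) r' m'"
      then show "runs (Add 2 2 0) (r'(3 := j)) m' 1 (I j)"
        by (intro runs_intros) (auto simp: I_def)
    next
      fix r' m' assume "I 0 r' m'"
      then have I: "m' = m" "r' 2 = n * n" "r' 0 = n" "r' 10 = 0" "r' 15 = 1"
        by (auto simp: I_def)
      then have "runs ?loop2 (r'(4 := n * n + n, 5 := diag, 3 := n, 6 := n * n)) m (n * 5 + 1) ?Q"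
        by (intro loop2) (auto simp: regs_def)
      then show "runs ?rest r' m' (n * 5 + 5) ?Q"
        using I by (intro runs_Seq_basic) (simp_all add: add.commute)
    qed (use r in \<open>auto simp: I_def\<close>)
  qed simp
  then show ?thesis
    using r unfolding setup_memory_def by (intro runs_Seq_basic) (simp_all add: add.commute)
qed

text \<open>The first \<open>n\<close> cells belong to the matrix until the last round, so the
  output is collected behind it and copied to the front only at the end.\<close>

definition greedy_program :: "nat \<Rightarrow> nat \<Rightarrow> com" where
  "greedy_program diag out = Seq (setup_memory diag) (Seq (Add 3 0 10)
     (Seq (Down 3 (greedy_round out))
     (Seq (Add 7 0 10) (Down 7 (Seq (Add 11 2 7) (Seq (Load 11 11) (Store 7 11)))))))"

text \<open>The time bound must hold on infeasible inputs too, so the existence of a cover enters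
  only through \<open>greedy_inv\<close>.\<close>

lemma runs_greedy_program:
  assumes r: "r 0 = n" "\<And>i. i \<noteq> 0 \<Longrightarrow> r i = 0"
    and m: "\<And>v w. v < n \<Longrightarrow> w < n \<Longrightarrow> v \<noteq> w \<Longrightarrow> m (v * n + w) = of_bool (w \<in> S v)"
      "\<And>a. n * n \<le> a \<Longrightarrow> m a = 0"
    and diag: "\<And>v. v < n \<Longrightarrow> diag = of_bool (v \<in> S v)"
    and S: "\<And>v. v < n \<Longrightarrow> S v \<subseteq> {..<n}"
  shows "runs (greedy_program diag out) r m (n * (n * (n * 8 + 19) + 12) + n * 13 + 12)
     (\<lambda>r' m'. \<exists>D. greedy_inv n S 0 D \<and> (\<forall>v<n. m' v = (if v \<in> D then out else 0)))"
    (is "runs _ _ _ _ ?Q")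
proof -
  let ?copy = "Seq (Add 11 2 7) (Seq (Load 11 11) (Store 7 11))"
  have copy: "runs (Seq (Add 7 0 10) (Down 7 ?copy)) r m (n * 5 + 2) ?Q"
    if mem: "greedy_memory n S out D m" and D: "greedy_inv n S 0 D" and r: "regs n r" for r m D
  proof -
    define I where "I k r' m' \<longleftrightarrow> regs n r' \<and> r' 7 = k \<and>
      (\<forall>v<n. m' (n * n + v) = (if v \<in> D then out else 0)) \<and>
      (\<forall>v<n. k \<le> v \<longrightarrow> m' v = (if v \<in> D then out else 0))" for k r' m'
    have "runs (Down 7 ?copy) (r(7 := n)) m (n * 5 + 1) ?Q"
    proof (rule runs_Down[where I = I and k = n and T = 3])
      show "I n (r(7 := n)) m"
        using r mem by (auto simp: I_def regs_def greedy_memory_def)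
    next
      fix j r' m' assume j: "j < n" and I: "I (Suc j) r' m'"
      \<comment> \<open>The target cells end at or before the start of the source block, so copying
        never overwrites a value still to be read.\<close>
      have "n \<le> n * n" by (cases n) auto
      then have ne: "j \<noteq> n * n + v" for v using j by linarith
      let ?x = "if j \<in> D then out else 0"
      have "j \<le> v \<longleftrightarrow> Suc j \<le> v" if "v \<noteq> j" for v
        using that by linarith
      then have "I j (r'(7 := j, 11 := ?x)) (m'(j := ?x))"
        using I ne ne[symmetric] unfolding I_def regs_def by simp
      moreover have "m' (n * n + j) = ?x" "r' 2 = n * n"
        using I j by (simp_all add: I_def regs_def)
      ultimately show "runs ?copy (r'(7 := j)) m' 3 (I j)"
        by (intro runs_intros) (simp_all split del: if_split)
    next
      fix r' m' assume "I 0 r' m'"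
      then show "?Q r' m'" using D by (auto simp: I_def)
    qed (auto simp: I_def regs_def)
    then show ?thesis
      using r by (intro runs_Seq_basic) (simp_all add: regs_def)
  qed
  have start: "greedy_inv n S n {}"
    using S by (intro greedy_inv_start) auto
  let ?T = "n * (n * (n * 8 + 19) + 12) + 1"
  have rounds: "runs (Seq (Down 3 (greedy_round out)) (Seq (Add 7 0 10) (Down 7 ?copy)))
      r m (?T + (n * 5 + 2)) ?Q"
    if mem: "greedy_memory n S out {} m" and r: "regs n r" "r 3 = n" for r m
  proof (rule runs_Seq)
    define I where "I k r' m' \<longleftrightarrow>
      (\<exists>D. greedy_inv n S k D \<and> greedy_memory n S out D m') \<and> regs n r' \<and> r' 3 = k" for k r' m'
    show "runs (Down 3 (greedy_round out)) r m ?T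
        (\<lambda>r' m'. runs (Seq (Add 7 0 10) (Down 7 ?copy)) r' m' (n * 5 + 2) ?Q)"
    proof (rule runs_Down[where I = I and k = n and T = "n * (n * 8 + 19) + 10"])
      show "I n r m"
        using mem r start by (auto simp: I_def)
    next
      fix j r' m' assume "I (Suc j) r' m'"
      then obtain D where D: "greedy_inv n S (Suc j) D" "greedy_memory n S out D m'" "regs n r'"
        by (auto simp: I_def)
      show "runs (greedy_round out) (r'(3 := j)) m' (n * (n * 8 + 19) + 10) (I j)"
        by (rule runs_mono[OF runs_greedy_round[OF D(2)]])
          (use D in \<open>auto simp: I_def regs_def intro: greedy_inv_step\<close>)
    next
      fix r' m' assume "I 0 r' m'"
      then show "runs (Seq (Add 7 0 10) (Down 7 ?copy)) r' m' (n * 5 + 2) ?Q"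
        unfolding I_def by (blast intro: copy)
    qed (auto simp: I_def regs_def)
  qed simp
  let ?main = "Seq (Add 3 0 10) (Seq (Down 3 (greedy_round out)) (Seq (Add 7 0 10) (Down 7 ?copy)))"
  have main: "runs ?main r m (1 + (?T + (n * 5 + 2))) ?Q"
    if "regs n r \<and> greedy_memory n S out {} m" for r m
    using that rounds[of m "r(3 := n)"] by (intro runs_Seq_basic) (simp_all add: regs_def)
  show ?thesis
    unfolding greedy_program_def
  proof (rule runs_Seq)
    show "runs (setup_memory diag) r m (n * 8 + 8)
        (\<lambda>r' m'. runs ?main r' m' (1 + (?T + (n * 5 + 2))) ?Q)"
      by (rule runs_mono[OF runs_setup_memory[where r = r and n = n and m = m and S = S and out = out,
          OF r m diag] order_refl main])
  qed simp
qed

section \<open>Approximation\<close>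

definition nbhd :: "bool \<Rightarrow> 'v pair_pre_digraph \<Rightarrow> 'v \<Rightarrow> 'v set" where
  "nbhd cl G v = (if cl then closed_nbhd G v else open_nbhd G v)"

lemma input_graphD:
  assumes "input_graph G"
  shows "pverts G = {..<card (pverts G)}" "(v, v) \<notin> parcs G"
    "(v, w) \<in> parcs G \<Longrightarrow> (w, v) \<in> parcs G"
    "(v, w) \<in> parcs G \<Longrightarrow> v \<in> pverts G \<and> w \<in> pverts G"
proof -
  interpret pair_graph G using assms by (simp add: input_graph_def)
  show "pverts G = {..<card (pverts G)}" using assms by (simp add: input_graph_def)
  show "(v, v) \<notin> parcs G" using pair_no_loops by fastforce
  show "(w, v) \<in> parcs G" if "(v, w) \<in> parcs G"
    using that pair_sym_arcs by (auto simp: symmetric_def sym_def)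
  show "v \<in> pverts G \<and> w \<in> pverts G" if "(v, w) \<in> parcs G"
    using that arc_fst_in_verts arc_snd_in_verts by fastforce
qed

lemma vertex_iff: "v \<in> pverts G \<longleftrightarrow> v < card (pverts G)" if "input_graph G"
  by (subst input_graphD(1)[OF that]) (rule lessThan_iff)

lemma nbhd_sym: "w \<in> nbhd cl G v \<longleftrightarrow> v \<in> nbhd cl G w" if "input_graph G"
  using input_graphD(3)[OF that] by (auto simp: nbhd_def closed_nbhd_def open_nbhd_def)

lemma nbhd_subset: "nbhd cl G v \<subseteq> pverts G" if "input_graph G" "v \<in> pverts G"
  using input_graphD(4)[OF that(1)] that(2)
  by (auto simp: nbhd_def closed_nbhd_def open_nbhd_def)

lemma finite_pverts: "finite (pverts G)" if "input_graph G"
  using input_graphD(1)[OF that] finite_lessThan by metis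

lemma finite_nbhd: "finite (nbhd cl G v)" if "input_graph G" "v \<in> pverts G"
  using nbhd_subset[OF that] finite_pverts[OF that(1)] by (rule finite_subset)

text \<open>By symmetry of adjacency, set cover by neighbourhoods is domination, total domination
  for open ones.\<close>

lemma covers_nbhd_iff:
  assumes "input_graph G"
  shows "covers (card (pverts G)) (nbhd cl G) D \<longleftrightarrow>
    D \<subseteq> pverts G \<and> (\<forall>v\<in>pverts G. \<exists>w\<in>nbhd cl G v. w \<in> D)"
  unfolding covers_def input_graphD(1)[OF assms, symmetric]
  using nbhd_sym[OF assms, of _ cl] by blast

lemma card_nbhd_le:
  assumes "input_graph G" "v \<in> pverts G"
  shows "card (nbhd cl G v) \<le> max_degree G + 1"
proof -
  have "card (open_nbhd G v) \<le> max_degree G"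
    unfolding max_degree_def using assms finite_pverts by (intro Max_ge) auto
  then show ?thesis
    using card_insert_le_m1[of "max_degree G + 1" "open_nbhd G v" v]
    by (auto simp: nbhd_def closed_nbhd_def)
qed

text \<open>Telescoping: \<open>ln x - ln y \<le> (x - y) / y\<close> bounds each new reciprocal by
  the increment of the logarithm.\<close>

lemma harm_Suc_le_ln: "harm (Suc n) \<le> ln (real (Suc n)) + 1"
proof (induction n)
  case (Suc n)
  have "ln (real (Suc n)) - ln (real (Suc (Suc n)))
      \<le> (real (Suc n) - real (Suc (Suc n))) / real (Suc (Suc n))"
    by (intro ln_diff_le) auto
  then have "inverse (real (Suc (Suc n))) \<le> ln (real (Suc (Suc n))) - ln (real (Suc n))"
    by (simp add: inverse_eq_divide)
  with Suc show ?case
    by (simp add: harm_Suc[of "Suc n"])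
qed (simp add: harm_expand)

lemma exec_greedy_program:
  assumes "input_graph G"
  shows "\<exists>t s D. exec (greedy_program (of_bool cl) out) (input_config G) t s \<and>
    t \<le> poly [:12, 25, 19, 8:] (card (pverts G)) \<and>
    greedy_inv (card (pverts G)) (nbhd cl G) 0 D \<and>
    (\<forall>v\<in>pverts G. snd s v = (if v \<in> D then out else 0))"
proof -
  let ?n = "card (pverts G)"
  obtain r m where rm: "input_config G = (r, m)" by fastforce
  have "r = (\<lambda>i. if i = 0 then ?n else 0)"
    and m: "m = (\<lambda>a. if a < ?n * ?n \<and> (a div ?n, a mod ?n) \<in> parcs G then 1 else 0)"
    using rm by (simp_all add: input_config_def Let_def)
  then have r: "r 0 = ?n" "\<And>i. i \<noteq> 0 \<Longrightarrow> r i = 0" by simp_all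
  have "runs (greedy_program (of_bool cl) out) r m
      (?n * (?n * (?n * 8 + 19) + 12) + ?n * 13 + 12)
      (\<lambda>r' m'. \<exists>D. greedy_inv ?n (nbhd cl G) 0 D \<and> (\<forall>v<?n. m' v = (if v \<in> D then out else 0)))"
  proof (rule runs_greedy_program[where r = r and n = ?n, OF r])
    fix v w assume "v < ?n" "w < ?n" "v \<noteq> w"
    then show "m (v * ?n + w) = of_bool (w \<in> nbhd cl G v)"
      using matrix_index_less[of v ?n w]
      by (auto simp: m nbhd_def closed_nbhd_def open_nbhd_def)
  next
    fix v assume "v < ?n"
    then show "nbhd cl G v \<subseteq> {..<?n}"
      using nbhd_subset[OF assms] vertex_iff[OF assms] by blast
  qed (use input_graphD(2)[OF assms] in \<open>auto simp: m nbhd_def closed_nbhd_def open_nbhd_def\<close>)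
  then obtain t r' m' D where run: "exec (greedy_program (of_bool cl) out) (r, m) t (r', m')"
      "t \<le> ?n * (?n * (?n * 8 + 19) + 12) + ?n * 13 + 12"
      "greedy_inv ?n (nbhd cl G) 0 D" "\<forall>v<?n. m' v = (if v \<in> D then out else 0)"
    unfolding runs_def by blast
  \<comment> \<open>The coefficient 25 of the linear term is 12 + 13.\<close>
  have "t \<le> poly [:12, 25, 19, 8:] ?n"
    using run(2) by (simp add: algebra_simps)
  moreover have "\<forall>v\<in>pverts G. snd (r', m') v = (if v \<in> D then out else 0)"
  proof
    fix v assume "v \<in> pverts G"
    then have "v < ?n" using vertex_iff[OF assms] by simp
    with run(4) show "snd (r', m') v = (if v \<in> D then out else 0)" by simp
  qed
  ultimately show ?thesis
    using run(1,3) unfolding rm by blast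
qed

lemma greedy_size_le:
  assumes G: "input_graph G"
    and D: "greedy_inv (card (pverts G)) (nbhd cl G) 0 D"
    and K: "covers (card (pverts G)) (nbhd cl G) K"
  shows "real (card D) \<le> real (card K) * (ln (real (max_degree G) + 2) + 1)"
proof -
  have "harm (card (nbhd cl G u)) \<le> ln (real (max_degree G) + 2) + 1" if "u \<in> K" for u
  proof -
    have "u \<in> pverts G" using that K unfolding covers_nbhd_iff[OF G] by auto
    \<comment> \<open>Going up from at most \<Delta> + 1 elements to the harmonic number of \<Delta>
      + 2 yields the argument of the logarithm in the claimed factor.\<close>
    then have "harm (card (nbhd cl G u)) \<le> (harm (Suc (max_degree G + 1)) :: real)"
      using card_nbhd_le[OF G, of u cl] by (intro harm_mono) simp
    also have "\<dots> \<le> ln (real (max_degree G) + 2) + 1"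
      using harm_Suc_le_ln[of "max_degree G + 1"] by (simp add: add_ac)
    finally show ?thesis .
  qed
  then have "(\<Sum>u\<in>K. harm (card (nbhd cl G u))) \<le> real (card K) * (ln (real (max_degree G) + 2) + 1)"
    by (rule sum_bounded_above)
  with greedy_inv_final(2)[OF D K] show ?thesis by linarith
qed

text \<open>A finite value excludes an empty feasible set, and a nonempty set of extended naturals
  contains its infimum.\<close>

lemma parameter_attained:
  assumes "parameter sz feas G \<noteq> \<infinity>"
  obtains f where "f \<in> feas G" "parameter sz feas G = enat (weight sz G f)"
proof -
  let ?A = "(\<lambda>f. enat (weight sz G f)) ` feas G"
  have "?A \<noteq> {}"
    using assms by (auto simp: parameter_def top_enat_def)
  then obtain k where "k \<in> ?A" by (meson ex_in_conv)
  then have "Inf ?A \<in> ?A" by (rule wellorder_InfI)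
  then obtain f where "f \<in> feas G" "Inf ?A = enat (weight sz G f)" by (elim imageE)
  then show ?thesis
    using that unfolding parameter_def by simp
qed

text \<open>All six parameters enter through \<open>feasible\<close> and \<open>support\<close>
  alone. The former makes the output feasible at weight \<open>2 * card D\<close>, the latter makes
  the support of an optimal function a cover.\<close>

lemma approximation_algorithm_greedy:
  assumes enc: "enc none = 0" "enc full = out" and sz: "sz none = 0" "sz full = 2"
    and feasible: "\<And>G D. input_graph G \<Longrightarrow> D \<subseteq> pverts G \<Longrightarrow>
      (\<forall>v\<in>pverts G. \<exists>w\<in>nbhd cl G v. w \<in> D) \<Longrightarrow> (\<lambda>v. if v \<in> D then full else none) \<in> feas G"
    and support: "\<And>G f v. input_graph G \<Longrightarrow> f \<in> feas G \<Longrightarrow> v \<in> pverts G \<Longrightarrow>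
      \<exists>w\<in>nbhd cl G v. sz (f w) \<noteq> 0"
  shows "approximation_algorithm enc sz feas (\<lambda>G. 2 * (ln (real (max_degree G) + 2) + 1))
    (greedy_program (of_bool cl) out)"
  unfolding approximation_algorithm_def
proof (intro conjI allI impI)
  show "polynomial_time (greedy_program (of_bool cl) out)"
    unfolding polynomial_time_def
  proof (intro exI[of _ "[:12, 25, 19, 8:]"] allI impI)
    fix G assume "input_graph G"
    from exec_greedy_program[OF this, of cl out]
    show "\<exists>t s. exec (greedy_program (of_bool cl) out) (input_config G) t s \<and>
        t \<le> poly [:12, 25, 19, 8:] (card (pverts G))"
      by (elim exE conjE) (intro exI conjI)
  qed
next
  fix G assume "input_graph G \<and> parameter sz feas G \<noteq> \<infinity>"
  then have G: "input_graph G" and "parameter sz feas G \<noteq> \<infinity>" by auto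
  then obtain f where f: "f \<in> feas G" "parameter sz feas G = enat (weight sz G f)"
    using parameter_attained[of sz feas G] by blast
  let ?N = "nbhd cl G" and ?n = "card (pverts G)"
  define K where "K = {v \<in> pverts G. sz (f v) \<noteq> 0}"
  have K: "covers ?n ?N K"
    unfolding covers_nbhd_iff[OF G]
  proof (intro conjI ballI)
    fix v assume v: "v \<in> pverts G"
    with support[OF G f(1)] obtain w where "w \<in> ?N v" "sz (f w) \<noteq> 0" by auto
    with nbhd_subset[OF G v] show "\<exists>w\<in>?N v. w \<in> K" unfolding K_def by blast
  qed (simp add: K_def)
  obtain t s D where run: "exec (greedy_program (of_bool cl) out) (input_config G) t s"
      "\<forall>v\<in>pverts G. snd s v = (if v \<in> D then out else 0)" and D: "greedy_inv ?n ?N 0 D"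
    using exec_greedy_program[OF G, of cl out] by blast
  define g where "g = (\<lambda>v. if v \<in> D then full else none)"
  have D_cov: "D \<subseteq> pverts G" "\<forall>v\<in>pverts G. \<exists>w\<in>?N v. w \<in> D"
    using greedy_inv_final(1)[OF D K] unfolding covers_nbhd_iff[OF G] by auto
  have "outputs enc (greedy_program (of_bool cl) out) G g"
  proof -
    have "\<forall>v\<in>pverts G. snd s v = enc (g v)"
      using run(2) enc by (simp add: g_def)
    with run(1) show ?thesis unfolding outputs_def by blast
  qed
  moreover have "g \<in> feas G"
    unfolding g_def using G D_cov by (rule feasible)
  moreover have "real (weight sz G g) \<le>
      2 * (ln (real (max_degree G) + 2) + 1) * real (the_enat (parameter sz feas G))"
  proof -
    have "weight sz G g = (\<Sum>v\<in>pverts G. if v \<in> D then 2 else 0)"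
      unfolding weight_def g_def by (intro sum.cong) (auto simp: sz)
    also have "\<dots> = 2 * card D"
      using finite_pverts[OF G] D_cov(1) by (simp add: sum.If_cases Int_absorb1)
    finally have wg: "weight sz G g = 2 * card D" .
    \<comment> \<open>Each vertex of the support carries weight at least 1, so the optimum is at
      least \<open>card K\<close>.\<close>
    have "card K = (\<Sum>v\<in>K. 1)" by simp
    also have "\<dots> \<le> (\<Sum>v\<in>K. sz (f v))"
      unfolding K_def by (intro sum_mono) auto
    also have "\<dots> \<le> weight sz G f"
      unfolding weight_def K_def using finite_pverts[OF G] by (intro sum_mono2) auto
    finally have "card K \<le> weight sz G f" .
    moreover have "0 \<le> ln (real (max_degree G) + 2) + 1"
      using ln_ge_zero[of "real (max_degree G) + 2"] by simp
    ultimately have "real (card K) * (ln (real (max_degree G) + 2) + 1) \<le>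
        real (weight sz G f) * (ln (real (max_degree G) + 2) + 1)"
      by (intro mult_right_mono) auto
    with greedy_size_le[OF G D K] show ?thesis
      by (simp add: wg f(2) algebra_simps)
  qed
  ultimately show "\<exists>f. outputs enc (greedy_program (of_bool cl) out) G f \<and> f \<in> feas G \<and>
      real (weight sz G f) \<le>
        2 * (ln (real (max_degree G) + 2) + 1) * real (the_enat (parameter sz feas G))"
    by blast
qed

section \<open>The six parameters\<close>

text \<open>Infinite sets have cardinality 0 by convention; finiteness of the colour type excludes
  them.\<close>

lemma card_colour_set_eq_0_iff: "card X = 0 \<longleftrightarrow> X = {}" for X :: "colour set"
proof -
  have "X \<subseteq> {A, B}" using colour.exhaust by auto
  then have "finite X" by (rule finite_subset) simp
  then show ?thesis by simp
qed

lemma member_le_sum_nbhd: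
  fixes f :: "nat \<Rightarrow> nat"
  assumes "input_graph G" "v \<in> pverts G" "w \<in> nbhd cl G v"
  shows "f w \<le> (\<Sum>u\<in>nbhd cl G v. f u)"
  using assms finite_nbhd by (intro member_le_sum) auto

lemma approximation_algorithm_numeric:
  assumes feasible: "\<And>G D. input_graph G \<Longrightarrow> D \<subseteq> pverts G \<Longrightarrow>
      (\<forall>v\<in>pverts G. \<exists>w\<in>nbhd cl G v. w \<in> D) \<Longrightarrow> (\<lambda>v. if v \<in> D then 2 else 0) \<in> feas G"
    and support: "\<And>G f v. input_graph G \<Longrightarrow> f \<in> feas G \<Longrightarrow> v \<in> pverts G \<Longrightarrow>
      \<exists>w\<in>nbhd cl G v. f w \<noteq> 0"
  shows "\<exists>P. approximation_algorithm id id feas (\<lambda>G. 2 * (ln (real (max_degree G) + 2) + 1)) P"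
  by (rule exI, rule approximation_algorithm_greedy[where none = 0 and full = 2 and cl = cl and out = 2])
    (simp_all only: id_apply feasible support)

lemma approximation_algorithm_colours:
  assumes feasible: "\<And>G D. input_graph G \<Longrightarrow> D \<subseteq> pverts G \<Longrightarrow>
      (\<forall>v\<in>pverts G. \<exists>w\<in>nbhd cl G v. w \<in> D) \<Longrightarrow> (\<lambda>v. if v \<in> D then {A, B} else {}) \<in> feas G"
    and support: "\<And>G f v. input_graph G \<Longrightarrow> f \<in> feas G \<Longrightarrow> v \<in> pverts G \<Longrightarrow>
      \<exists>w\<in>nbhd cl G v. f w \<noteq> {}"
  shows "\<exists>P. approximation_algorithm enc_colours card feas
    (\<lambda>G. 2 * (ln (real (max_degree G) + 2) + 1)) P"
proof -
  \<comment> \<open>The code of the full colour set is 1 + 2, hence \<open>out = 3\<close>, although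
    its weight is 2.\<close>
  have enc: "enc_colours {} = 0" "enc_colours {A, B} = 3" "card {A, B} = 2"
    by (simp_all add: enc_colours_def)
  show ?thesis
    by (rule exI, rule approximation_algorithm_greedy[where none = "{}" and full = "{A, B}"
          and cl = cl and out = 3])
      (simp_all only: enc card.empty card_colour_set_eq_0_iff feasible support)
qed

theorem mainTheorem4:
  shows "(\<forall>feas \<in> {two_dom, total_two_dom, roman_dom}.
            \<exists>P. approximation_algorithm id id feas
                  (\<lambda>G. 2 * (ln (real (max_degree G) + 2) + 1)) P) \<and>
         (\<forall>feas \<in> {weak_two_rainbow_dom, rainbow_two_dom, rainbow_total_two_dom}.
            \<exists>P. approximation_algorithm enc_colours card feas
                  (\<lambda>G. 2 * (ln (real (max_degree G) + 2) + 1)) P)"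
proof -
  have nbhd_eq: "closed_nbhd = nbhd True" "open_nbhd = nbhd False"
    by (simp_all add: fun_eq_iff nbhd_def)
  have closed_nbhd_iff: "(\<exists>w\<in>nbhd True G v. P w) \<longleftrightarrow> P v \<or> (\<exists>w\<in>nbhd False G v. P w)" for G v P
    by (auto simp: nbhd_def closed_nbhd_def)
  have sum_ge: "2 \<le> (\<Sum>u\<in>nbhd cl G v. if u \<in> D then 2 else 0 :: nat)"
    if "input_graph G" "v \<in> pverts G" "\<exists>w\<in>nbhd cl G v. w \<in> D" for cl G v D
  proof -
    from that(3) obtain w where "w \<in> nbhd cl G v" "w \<in> D" by blast
    then show ?thesis
      using member_le_sum_nbhd[OF that(1,2), of w cl "\<lambda>u. if u \<in> D then 2 else 0"] by simp
  qed
  have ex_nonzero: "\<exists>w\<in>N. f w \<noteq> 0" if "2 \<le> (\<Sum>w\<in>N. f w)" for N and f :: "nat \<Rightarrow> nat"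
    using that by (metis not_numeral_le_zero sum.neutral)
  have ex_nonempty: "\<exists>w\<in>N. f w \<noteq> {}" if "(\<Union>w\<in>N. f w) = {A, B}" for N and f :: "nat \<Rightarrow> colour set"
    using that by blast
  have Union_eq: "(\<Union>u\<in>N. if u \<in> D then {A, B} else {}) = {A, B}"
    if "\<exists>w\<in>N. w \<in> D" for N D :: "nat set"
    using that by auto
  have numeric: "\<exists>P. approximation_algorithm id id feas (\<lambda>G. 2 * (ln (real (max_degree G) + 2) + 1)) P"
    if feas: "feas = (\<lambda>G. {f. f \<in> pverts G \<rightarrow> {0, 1, 2} \<and>
      (\<forall>v\<in>pverts G. 2 \<le> (\<Sum>w\<in>nbhd cl G v. f w))})"
    for cl and feas :: "nat pair_pre_digraph \<Rightarrow> _"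
  proof (rule approximation_algorithm_numeric[where cl = cl])
    fix G D assume "input_graph G" "\<forall>v\<in>pverts G. \<exists>w\<in>nbhd cl G v. w \<in> D"
    then have "\<forall>v\<in>pverts G. 2 \<le> (\<Sum>u\<in>nbhd cl G v. if u \<in> D then 2 else 0 :: nat)"
      using sum_ge by blast
    then show "(\<lambda>v. if v \<in> D then 2 else 0) \<in> feas G"
      unfolding feas by (intro CollectI conjI) auto
  next
    fix G :: "nat pair_pre_digraph" and f v assume "f \<in> feas G" "v \<in> pverts G"
    then show "\<exists>w\<in>nbhd cl G v. f w \<noteq> 0"
      unfolding feas using ex_nonzero by blast
  qed
  have rainbow: "\<exists>P. approximation_algorithm enc_colours card feas
      (\<lambda>G. 2 * (ln (real (max_degree G) + 2) + 1)) P"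
    if feas: "feas = (\<lambda>G. {f. \<forall>v\<in>pverts G. (\<Union>w\<in>nbhd cl G v. f w) = {A, B}})"
    for cl and feas :: "nat pair_pre_digraph \<Rightarrow> _"
  proof (rule approximation_algorithm_colours[where cl = cl])
    fix G :: "nat pair_pre_digraph" and D assume "\<forall>v\<in>pverts G. \<exists>w\<in>nbhd cl G v. w \<in> D"
    then show "(\<lambda>v. if v \<in> D then {A, B} else {}) \<in> feas G"
      unfolding feas using Union_eq by (intro CollectI ballI) blast
  next
    fix G :: "nat pair_pre_digraph" and f v assume "f \<in> feas G" "v \<in> pverts G"
    then show "\<exists>w\<in>nbhd cl G v. f w \<noteq> {}"
      unfolding feas using ex_nonempty by blast
  qed
  \<comment> \<open>Either \<open>f v\<close> is nonzero or some neighbour has value 2; both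
    witnesses lie in the closed neighbourhood, whence \<open>cl = True\<close>.\<close>
  have "\<exists>P. approximation_algorithm id id roman_dom
      (\<lambda>G. 2 * (ln (real (max_degree G) + 2) + 1)) P"
  proof (rule approximation_algorithm_numeric[where cl = True])
    fix G :: "nat pair_pre_digraph" and D assume "\<forall>v\<in>pverts G. \<exists>w\<in>nbhd True G v. w \<in> D"
    then show "(\<lambda>v. if v \<in> D then 2 else 0) \<in> roman_dom G"
      by (auto simp: roman_dom_def nbhd_eq closed_nbhd_iff)
  next
    fix G :: "nat pair_pre_digraph" and f v assume "f \<in> roman_dom G" "v \<in> pverts G"
    then show "\<exists>w\<in>nbhd True G v. f w \<noteq> 0"
      unfolding roman_dom_def nbhd_eq closed_nbhd_iff by force
  qed
  moreover have "\<exists>P. approximation_algorithm enc_colours card weak_two_rainbow_dom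
      (\<lambda>G. 2 * (ln (real (max_degree G) + 2) + 1)) P"
  proof (rule approximation_algorithm_colours[where cl = True])
    fix G :: "nat pair_pre_digraph" and D assume *: "\<forall>v\<in>pverts G. \<exists>w\<in>nbhd True G v. w \<in> D"
    \<comment> \<open>The dominating vertex of some \<open>v\<close> outside \<open>D\<close>
      differs from \<open>v\<close>, so it already lies in the open neighbourhood.\<close>
    have "(\<Union>w\<in>nbhd False G v. if w \<in> D then {A, B} else {}) = {A, B}"
      if "v \<in> pverts G" "v \<notin> D" for v
      using * that by (intro Union_eq) (auto simp: closed_nbhd_iff)
    then show "(\<lambda>v. if v \<in> D then {A, B} else {}) \<in> weak_two_rainbow_dom G"
      unfolding weak_two_rainbow_dom_def nbhd_eq by (intro CollectI ballI impI) (metis insert_not_empty)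
  next
    fix G :: "nat pair_pre_digraph" and f v assume "f \<in> weak_two_rainbow_dom G" "v \<in> pverts G"
    then show "\<exists>w\<in>nbhd True G v. f w \<noteq> {}"
      unfolding weak_two_rainbow_dom_def nbhd_eq closed_nbhd_iff using ex_nonempty by blast
  qed
  moreover note numeric[of two_dom True] numeric[of total_two_dom False]
    rainbow[of rainbow_two_dom True] rainbow[of rainbow_total_two_dom False]
  ultimately show ?thesis
    by (simp add: fun_eq_iff two_dom_def total_two_dom_def rainbow_two_dom_def
        rainbow_total_two_dom_def nbhd_eq)
qed

end
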